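(* Let $A\subseteq \mathbb{N}$ satisfy $\operatorname{BD}(A)>\frac{1}{2}$. Then there are infinite sets $B,C\subseteq \mathbb{N}$ with $C\subseteq A$ such that $B+C\subseteq A$.
   Context: $\mathbb{N}=\{1,2,3,\dots\}$ (0 is not included). For $a,b\in\mathbb{N}$, $[a,b]=\{c\in\mathbb{N}: a\le c\le b\}$. For $B,C\subseteq\mathbb{N}$, $B+C=\{b+c: b\in B, c\in C\}$. The (upper) Banach density of $A\subseteq\mathbb{N}$ is $\operatorname{BD}(A)=\lim_{n\to\infty}\sup_{m\in\mathbb{N}}\frac{|A\cap[m,m+n]|}{n}$. *)

theory Defs
  imports "HOL-Analysis.Analysis"
begin

text \<open>Naturals here are positive: we work with sets A of nat with 0 excluded.
  The interval [m, m+n] = {m..m+n}. Upper Banach density as the limit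
  (as n tends to infinity) of sup over m of card(A inter [m,m+n]) / n.\<close>

definition banach_density :: "nat set \<Rightarrow> real" where
  "banach_density A =
     lim (\<lambda>n. SUP m\<in>{1::nat..}. real (card (A \<inter> {m..m+n})) / real n)"

end

theory Submission
  imports Defs "HOL-Complex_Analysis.Great_Picard" "HOL-Real_Asymp.Real_Asymp"
begin

text \<open>
  Fix 1/2 < \<gamma> < \<beta> < BD(A) and intervals I n of growing length on which A has density at least
  \<beta>. By double counting, for each n the c for which A - c has density at least \<gamma> on I n have
  positive density on I m for all large m. Bergelson's intersectivity lemma therefore gives a
  subsequence of the I n and points c k, tending to infinity, such that A - c k has density at
  least \<gamma> on the first k intervals of the subsequence; after a further thinning A - c k converges
  pointwise to a set L of density at least \<gamma> on all of them. Since each A - c k has asymptotic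
  density at least \<beta> there and \<beta> + \<gamma> > 1, the sets L \<inter> (A - c k) have uniformly positive density,
  and a second use of intersectivity makes all their finite intersections infinite. Then B in L
  and C among the c k can be chosen alternately. Finally C \<subseteq> A costs nothing: translate C by an
  element of B, and B back by the same amount.
\<close>

section \<open>Subadditive sequences\<close>

text \<open>Write \<open>n = q * k + r\<close> with \<open>r < k\<close>: subadditivity gives
  \<open>a n \<le> q * a k + a r\<close>. For fixed \<open>k\<close> the last term is bounded, so
  \<open>a n / n\<close> is eventually below any number above \<open>a k / k\<close>.\<close>

lemma fekete:
  fixes a :: "nat \<Rightarrow> real"
  assumes nonneg: "\<And>n. 0 \<le> a n" and sub: "\<And>m n. a (m + n) \<le> a m + a n"
  shows "(\<lambda>n. a n / n) \<longlonglongrightarrow> (INF n\<in>{1..}. a n / real n)"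
proof -
  define l where "l = (INF n\<in>{1..}. a n / real n)"
  have bdd: "bdd_below ((\<lambda>n. a n / real n) ` {1..})"
    by (rule bdd_belowI[of _ 0]) (auto simp: nonneg)
  have lower: "l \<le> a n / n" if "n \<ge> 1" for n
    unfolding l_def using that by (intro cINF_lower bdd) auto
  have mult: "a (q * k + r) \<le> q * a k + a r" for q k r
  proof (induction q)
    case (Suc q)
    have "a (Suc q * k + r) \<le> a k + a (q * k + r)"
      using sub[of k "q * k + r"] by (simp add: algebra_simps)
    with Suc show ?case by (simp add: algebra_simps)
  qed simp
  show ?thesis unfolding l_def[symmetric]
  proof (rule order_tendstoI)
    fix y assume "y < l"
    then show "\<forall>\<^sub>F n in sequentially. y < a n / n"
      using lower by (intro eventually_sequentiallyI[of 1]) fastforce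
  next
    fix y assume "l < y"
    then obtain k where k: "k \<ge> 1" "a k / k < y"
      unfolding l_def using cINF_less_iff[OF _ bdd] by auto
    define M where "M = (\<Sum>r<k. a r)"
    have "a r \<le> M" if "r < k" for r
      unfolding M_def using that nonneg by (intro member_le_sum) auto
    then have bound: "a n / n \<le> a k / k + M / n" if "n \<ge> 1" for n
    proof -
      have "a n \<le> (n div k) * a k + a (n mod k)"
        using mult[of "n div k" k "n mod k"] by simp
      also have "\<dots> \<le> (n / k) * a k + M"
        using \<open>\<And>r. r < k \<Longrightarrow> a r \<le> M\<close>[of "n mod k"] k nonneg[of k]
        by (intro add_mono mult_right_mono) (auto simp: of_nat_div_le_of_nat)
      finally show ?thesis
        using that k by (simp add: field_simps)
    qed
    have "(\<lambda>n. a k / k + M / n) \<longlonglongrightarrow> a k / k + 0"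
      by (intro tendsto_intros lim_const_over_n)
    then have "\<forall>\<^sub>F n in sequentially. a k / k + M / n < y"
      using k by (intro order_tendstoD) auto
    then show "\<forall>\<^sub>F n in sequentially. a n / n < y"
      using eventually_ge_at_top[of 1] by eventually_elim (use bound in fastforce)
  qed
qed

section \<open>Intersectivity of sets of positive density\<close>

text \<open>Otherwise each index in \<open>M\<close> overlaps all but finitely many others in
  density below any given \<open>e\<close>. Greedy choice then yields sets with tiny pairwise
  overlaps, each adding density at least \<open>d / 2\<close>, until their union has density above
  1.\<close>

lemma infinite_positive_overlap:
  fixes J :: "nat \<Rightarrow> 'a set" and Y :: "nat \<Rightarrow> 'a set"
  assumes J: "\<And>m. finite (J m)" "\<And>m. J m \<noteq> {}"
    and D: "\<And>i j. (\<lambda>m. card (Y i \<inter> Y j \<inter> J m) / card (J m)) \<longlonglongrightarrow> D i j"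
    and pos: "\<And>i. i \<in> M \<Longrightarrow> d \<le> D i i" "0 < d" and "infinite M"
  shows "\<exists>i\<in>M. \<exists>e>0. infinite {j \<in> M. e \<le> D i j}"
proof (rule ccontr)
  assume "\<not> ?thesis"
  then have fin: "finite {j \<in> M. e \<le> D i j}" if "i \<in> M" "e > 0" for i e
    using that by blast
  obtain K :: nat where K: "1 < K * (d / 2)"
    using pos(2) reals_Archimedean3[of "d / 2"] by (meson half_gt_zero)
  then have "K > 0" by (cases K) auto
  \<comment> \<open>Overlaps with at most \<open>K\<close> earlier sets total at most
    \<open>K * e = d / 4\<close>, so a new set of density above \<open>3 / 4 * d\<close> still adds
    \<open>d / 2\<close>. By the choice of \<open>K\<close>, such gains in \<open>K\<close> steps
    exceed 1.\<close>
  define e where "e = d / (4 * K)"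
  have "e > 0" using \<open>K > 0\<close> pos(2) by (simp add: e_def)
  have "\<exists>T. finite T \<and> T \<subseteq> M \<and> card T = k \<and>
      (\<forall>\<^sub>F m in sequentially. k * (d / 2) \<le> card ((\<Union>i\<in>T. Y i) \<inter> J m) / card (J m))"
    if "k \<le> K" for k
    using that
  proof (induction k)
    case 0
    show ?case by (intro exI[of _ "{}"]) auto
  next
    case (Suc k)
    then obtain T where T: "finite T" "T \<subseteq> M" "card T = k"
      and ev: "\<forall>\<^sub>F m in sequentially. k * (d / 2) \<le> card ((\<Union>i\<in>T. Y i) \<inter> J m) / card (J m)"
      by auto
    have "finite (T \<union> (\<Union>i\<in>T. {j \<in> M. e \<le> D i j}))"
      using T fin \<open>e > 0\<close> by auto
    with \<open>infinite M\<close> have "\<not> M \<subseteq> T \<union> (\<Union>i\<in>T. {j \<in> M. e \<le> D i j})"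
      using finite_subset by blast
    then obtain a where a: "a \<in> M" "a \<notin> T" "\<And>i. i \<in> T \<Longrightarrow> D i a < e"
      by force
    have "\<forall>\<^sub>F m in sequentially. \<forall>i\<in>T. card (Y i \<inter> Y a \<inter> J m) / card (J m) < e"
      using T(1) a(3) order_tendstoD(2)[OF D] by (intro eventually_ball_finite) auto
    moreover have "\<forall>\<^sub>F m in sequentially. 3 / 4 * d < card (Y a \<inter> Y a \<inter> J m) / card (J m)"
      using pos(1)[OF a(1)] pos(2) by (intro order_tendstoD(1)[OF D]) auto
    ultimately have "\<forall>\<^sub>F m in sequentially. Suc k * (d / 2)
        \<le> card ((\<Union>i\<in>insert a T. Y i) \<inter> J m) / card (J m)"
      using ev
    proof eventually_elim
      case (elim m)
      define N where "N = real (card (J m))"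
      have "N > 0" using J by (simp add: N_def card_gt_0_iff)
      let ?U = "(\<Union>i\<in>T. Y i) \<inter> J m"
      have "card (?U \<inter> (Y a \<inter> J m)) = card (\<Union>i\<in>T. Y i \<inter> Y a \<inter> J m)"
        by (rule arg_cong[of _ _ card]) auto
      also have "\<dots> \<le> (\<Sum>i\<in>T. card (Y i \<inter> Y a \<inter> J m))"
        by (rule card_UN_le[OF T(1)])
      finally have "card (?U \<inter> (Y a \<inter> J m)) \<le> (\<Sum>i\<in>T. real (card (Y i \<inter> Y a \<inter> J m)))"
        by (metis of_nat_le_iff of_nat_sum)
      also have "\<dots> \<le> (\<Sum>i\<in>T. e * N)"
        using elim(1) \<open>N > 0\<close> by (intro sum_mono) (fastforce simp: N_def field_simps)
      also have "\<dots> \<le> K * (e * N)"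
        using T(3) Suc.prems \<open>e > 0\<close> \<open>N > 0\<close> by (simp add: mult_right_mono)
      also have "\<dots> = d / 4 * N"
        using \<open>K > 0\<close> by (simp add: e_def)
      finally have 1: "card (?U \<inter> (Y a \<inter> J m)) \<le> d / 4 * N" .
      have 2: "3 / 4 * d * N \<le> card (Y a \<inter> J m)"
        using elim(2) \<open>N > 0\<close> by (simp add: N_def field_simps)
      have 3: "k * (d / 2) * N \<le> card ?U"
        using elim(3) \<open>N > 0\<close> by (simp add: N_def field_simps)
      have "(\<Union>i\<in>insert a T. Y i) \<inter> J m = ?U \<union> (Y a \<inter> J m)" by auto
      then have "real (card ((\<Union>i\<in>insert a T. Y i) \<inter> J m)) + card (?U \<inter> (Y a \<inter> J m))
          = real (card ?U) + card (Y a \<inter> J m)"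
        using card_Un_Int[of ?U "Y a \<inter> J m"] J(1) by (simp flip: of_nat_add)
      with 1 2 3 have "Suc k * (d / 2) * N \<le> card ((\<Union>i\<in>insert a T. Y i) \<inter> J m)"
        by (simp add: algebra_simps)
      then show ?case using \<open>N > 0\<close> by (simp add: N_def pos_le_divide_eq)
    qed
    then show ?case
      using T a by (intro exI[of _ "insert a T"]) auto
  qed
  from this[of K] obtain T
    where "\<forall>\<^sub>F m in sequentially. K * (d / 2) \<le> card ((\<Union>i\<in>T. Y i) \<inter> J m) / card (J m)"
    by blast
  then obtain m where m: "K * (d / 2) \<le> card ((\<Union>i\<in>T. Y i) \<inter> J m) / card (J m)"
    using eventually_happens'[OF sequentially_bot] by blast
  have "card ((\<Union>i\<in>T. Y i) \<inter> J m) / card (J m) \<le> 1"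
    using J by (simp add: divide_le_eq_1 card_mono card_gt_0_iff)
  with m K show False by linarith
qed

text \<open>There are countably many finite index sets, so along a subsequence of \<open>J\<close>
  all finite intersections have limiting densities; where these are positive the intersection is
  infinite. Indices are then picked one by one with \<open>infinite_positive_overlap\<close>, which
  keeps the density positive and leaves infinitely many candidates.\<close>

lemma bergelson_intersectivity:
  fixes E :: "nat \<Rightarrow> 'a set" and J :: "nat \<Rightarrow> 'a set" and d :: real
  assumes fin: "\<And>m. finite (J m)" and card: "filterlim (\<lambda>m. card (J m)) at_top sequentially"
    and "d > 0" and dense: "\<And>n. \<forall>\<^sub>F m in sequentially. d * card (J m) \<le> card (E n \<inter> J m)"
  shows "\<exists>s. strict_mono s \<and> (\<forall>k::nat. infinite (\<Inter>i\<le>k. E (s i)))"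
proof -
  define \<rho> where "\<rho> m F = card (\<Inter>(E ` F) \<inter> J m) / card (J m)" for m F
  have \<rho>_bound: "norm (\<rho> m F) \<le> 1" for m F
    using fin by (auto simp: \<rho>_def divide_le_eq_1 card_mono card_gt_0_iff)
  obtain r where r: "strict_mono r"
    and "\<And>F. F \<in> Collect finite \<Longrightarrow> \<exists>l. (\<lambda>m. \<rho> (r m) F) \<longlonglongrightarrow> l"
    using function_convergent_subsequence[of "Collect finite" \<rho> 1]
      countable_Collect_finite_subset[of "UNIV :: nat set"] \<rho>_bound by auto
  then obtain D where D: "\<And>F. finite F \<Longrightarrow> (\<lambda>m. \<rho> (r m) F) \<longlonglongrightarrow> D F"
    by (metis mem_Collect_eq)
  have card_r: "filterlim (\<lambda>m. card (J (r m))) at_top sequentially"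
    using filterlim_compose[OF card filterlim_subseq[OF r]] .
  then have "\<forall>\<^sub>F m in sequentially. 1 \<le> card (J (r m))"
    by (rule filterlim_at_top[THEN iffD1, rule_format])
  then obtain m0 where m0: "\<And>m. m0 \<le> m \<Longrightarrow> 1 \<le> card (J (r m))"
    by (auto simp: eventually_sequentially)
  \<comment> \<open>The shift by \<open>m0\<close> skips sets that may be empty, since
    \<open>infinite_positive_overlap\<close> needs all of them nonempty.\<close>
  define J' where "J' m = J (r (m + m0))" for m
  have J': "finite (J' m)" "J' m \<noteq> {}" for m
    using fin m0[of "m + m0"] by (auto simp: J'_def)
  have D': "(\<lambda>m. card (\<Inter>(E ` F) \<inter> J' m) / card (J' m)) \<longlonglongrightarrow> D F" if "finite F" for F
    using LIMSEQ_ignore_initial_segment[OF D[OF that], of m0] by (simp add: \<rho>_def J'_def)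
  have singleton: "d \<le> D {n}" for n
  proof (rule tendsto_lowerbound[OF D'])
    have "\<forall>\<^sub>F m in sequentially. d * card (J (r m)) \<le> card (E n \<inter> J (r m))"
      using filterlim_subseq[OF r] dense by (rule eventually_compose_filterlim[rotated])
    then have "\<forall>\<^sub>F m in sequentially. d * card (J' m) \<le> card (E n \<inter> J' m)"
      unfolding J'_def by (subst eventually_sequentially_seg)
    then show "\<forall>\<^sub>F m in sequentially. d \<le> card (\<Inter>(E ` {n}) \<inter> J' m) / card (J' m)"
      by eventually_elim (use J' in \<open>simp add: pos_le_divide_eq card_gt_0_iff\<close>)
  qed auto
  have positive_infinite: "infinite (\<Inter>(E ` F))" if "finite F" "D F > 0" for F
  proof
    assume I: "finite (\<Inter>(E ` F))"
    have lim: "filterlim (\<lambda>m. real (card (J (r m)))) at_top sequentially"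
      by (rule filterlim_compose[OF filterlim_real_sequentially card_r])
    have "(\<lambda>m. card (\<Inter>(E ` F)) / card (J (r m))) \<longlonglongrightarrow> 0"
      by (rule real_tendsto_divide_at_top[OF tendsto_const lim])
    then have "(\<lambda>m. \<rho> (r m) F) \<longlonglongrightarrow> 0"
      by (rule tendsto_sandwich[OF _ _ tendsto_const, rotated 2])
         (auto simp: \<rho>_def I intro!: always_eventually divide_right_mono card_mono)
    with D[OF that(1)] that(2) show False
      using LIMSEQ_unique by fastforce
  qed
  text \<open>A state is a finite set of chosen indices together with an infinite reservoir of
    indices, each of which still meets the chosen ones in uniformly positive density.\<close>
  define P where "P = (\<lambda>(F, M). finite F \<and> infinite M \<and> D F > 0 \<and>
    (\<exists>e>0. \<forall>j\<in>M. e \<le> D (insert j F)))"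
  define Q where "Q = (\<lambda>(F :: nat set, M) (F', M'). \<exists>i. (\<forall>j\<in>F. j < i) \<and> F' = insert i F \<and> M' \<subseteq> (M :: nat set))"
  have "\<exists>f. \<forall>n::nat. P (f n) \<and> Q (f n) (f (Suc n))"
  proof (rule dependent_nat_choice[where P = "\<lambda>_. P" and Q = "\<lambda>_. Q"])
    have "D {} > 0"
    proof -
      have "(\<lambda>m. card (\<Inter>(E ` {}) \<inter> J' m) / card (J' m)) = (\<lambda>m. 1)"
        using J' by auto
      with D'[of "{}"] have "D {} = 1"
        using LIMSEQ_unique[OF _ tendsto_const] by fastforce
      then show ?thesis by simp
    qed
    then have "P ({}, UNIV)"
      using singleton \<open>d > 0\<close> by (auto simp: P_def)
    then show "\<exists>x. P x" ..
  next
    fix x assume "P x"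
    then obtain F M e where x: "x = (F, M)" and F: "finite F" "infinite M"
      and e: "e > 0" "\<And>j. j \<in> M \<Longrightarrow> e \<le> D (insert j F)"
      by (auto simp: P_def)
    \<comment> \<open>Keeping only indices above \<open>F\<close> makes the final sequence
      \<open>s\<close> strictly increasing.\<close>
    define M' where "M' = {i \<in> M. \<forall>j\<in>F. j < i}"
    have "M - {..Max F} \<subseteq> M'"
      unfolding M'_def using Max_ge[OF F(1)] by fastforce
    then have "infinite M'"
      using F(2) by (meson Diff_infinite_finite finite_atMost infinite_super)
    \<comment> \<open>The overlap of \<open>Y i\<close> and \<open>Y j\<close> is the intersection
      for \<open>F\<close> with \<open>i\<close> and \<open>j\<close> added; for
      \<open>i = j\<close> the reservoir bound \<open>e\<close> applies.\<close>
    define Y where "Y i = \<Inter>(E ` insert i F)" for i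
    have "(\<lambda>m. card (Y i \<inter> Y j \<inter> J' m) / card (J' m)) \<longlonglongrightarrow> D (insert i (insert j F))" for i j
    proof -
      have "Y i \<inter> Y j = \<Inter>(E ` insert i (insert j F))" by (auto simp: Y_def)
      with D'[of "insert i (insert j F)"] F(1) show ?thesis by simp
    qed
    moreover have "e \<le> D (insert i (insert i F))" if "i \<in> M'" for i
      using that e(2) by (simp add: M'_def)
    ultimately obtain i e' where i: "i \<in> M'" "e' > 0" "infinite {j \<in> M'. e' \<le> D (insert i (insert j F))}"
      using infinite_positive_overlap[where J = J' and Y = Y and M = M' and d = e
            and D = "\<lambda>i j. D (insert i (insert j F))", OF J']
        \<open>infinite M'\<close> e(1) by blast
    have "P (insert i F, {j \<in> M'. e' \<le> D (insert i (insert j F))})"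
      using i F e(2)[of i] e(1) by (auto simp: P_def M'_def insert_commute intro!: exI[of _ e'])
    moreover have "Q x (insert i F, {j \<in> M'. e' \<le> D (insert i (insert j F))})"
      using i(1) by (auto simp: Q_def x M'_def)
    ultimately show "\<exists>y. P y \<and> Q x y" by blast
  qed
  then obtain f where f: "\<And>n. P (f n)" "\<And>n. Q (f n) (f (Suc n))" by blast
  define F where "F n = fst (f n)" for n
  have "\<exists>i. (\<forall>j\<in>F n. j < i) \<and> F (Suc n) = insert i (F n)" for n
    using f(2)[of n] by (auto simp: Q_def F_def split: prod.splits)
  then obtain s where s: "\<And>n j. j \<in> F n \<Longrightarrow> j < s n" "\<And>n. F (Suc n) = insert (s n) (F n)"
    by metis
  have "strict_mono s"
    unfolding strict_mono_Suc_iff using s by auto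
  moreover have "infinite (\<Inter>i\<le>k. E (s i))" for k
  proof -
    have "s i \<in> F (i + Suc j)" for i j
      by (induction j) (simp_all add: s(2))
    then have "s i \<in> F (Suc k)" if "i \<le> k" for i
      using that by (metis add_Suc_right le_iff_add)
    then have "\<Inter>(E ` F (Suc k)) \<subseteq> (\<Inter>i\<le>k. E (s i))" by blast
    moreover have "infinite (\<Inter>(E ` F (Suc k)))"
      using f(1)[of "Suc k"] positive_infinite by (auto simp: P_def F_def split: prod.splits)
    ultimately show ?thesis using infinite_super by blast
  qed
  ultimately show ?thesis by blast
qed

section \<open>Dense intervals from Banach density\<close>

text \<open>\<open>lim\<close> yields information only once convergence is known. The supremum
  \<open>a n\<close> of the counts over intervals of \<open>n\<close> points is subadditive, so the
  density is the infimum of \<open>a n / n\<close>; hence intervals of every positive length, not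
  only long ones, reach density \<open>\<beta>\<close>.\<close>

lemma banach_density_intervals:
  assumes "\<beta> < banach_density A"
  obtains u where "\<And>n. \<beta> * Suc n \<le> card (A \<inter> {u n..<u n + Suc n})"
proof -
  define a where "a n = (SUP m\<in>{1..}. real (card (A \<inter> {m..<m + n})))" for n
  have card_le: "card (A \<inter> {m..<m + n}) \<le> n" for m n
    using card_mono[of "{m..<m + n}" "A \<inter> {m..<m + n}"] by simp
  have bdd: "bdd_above ((\<lambda>m. real (card (A \<inter> {m..<m + n}))) ` {1..})" for n
    using card_le by (intro bdd_aboveI[of _ "real n"]) auto
  have upper: "card (A \<inter> {m..<m + n}) \<le> a n" if "m \<ge> 1" for m n
    unfolding a_def using that by (intro cSUP_upper bdd) auto
  have least: "a n \<le> y" if "\<And>m. m \<ge> 1 \<Longrightarrow> card (A \<inter> {m..<m + n}) \<le> y" for n and y :: real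
    unfolding a_def using that by (intro cSUP_least) auto
  have nonneg: "0 \<le> a n" for n
    using upper[of 1 n] by (meson of_nat_0_le_iff order_trans order_refl)
  have sub: "a (m + n) \<le> a m + a n" for m n
  proof (rule least)
    fix x :: nat assume "1 \<le> x"
    have "A \<inter> {x..<x + (m + n)} = (A \<inter> {x..<x + m}) \<union> (A \<inter> {x + m..<x + m + n})"
      by auto
    then have "card (A \<inter> {x..<x + (m + n)}) \<le> card (A \<inter> {x..<x + m}) + card (A \<inter> {x + m..<x + m + n})"
      by (metis card_Un_le)
    with upper[of x m] upper[of "x + m" n] \<open>1 \<le> x\<close>
    show "real (card (A \<inter> {x..<x + (m + n)})) \<le> a m + a n" by simp
  qed
  define l where "l = (INF n\<in>{1..}. a n / real n)"
  have lim_a: "(\<lambda>n. a n / n) \<longlonglongrightarrow> l"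
    unfolding l_def using nonneg sub by (rule fekete)
  have lower: "l \<le> a n / n" if "n \<ge> 1" for n
    unfolding l_def using that
    by (intro cINF_lower bdd_belowI[of _ 0]) (auto simp: nonneg)
  \<comment> \<open>The closed interval has \<open>n + 1\<close> points but the count is divided by
    \<open>n\<close>; the factor \<open>1 + 1 / n\<close> below accounts for this in the
    limit.\<close>
  have density_eq: "(SUP m\<in>{1::nat..}. real (card (A \<inter> {m..m+n})) / real n) = a (Suc n) / n"
    if "n \<ge> 1" for n
  proof (rule cSup_eq_non_empty)
    fix x assume "x \<in> (\<lambda>m. real (card (A \<inter> {m..m + n})) / real n) ` {1..}"
    then show "x \<le> a (Suc n) / n"
      using upper[of _ "Suc n"] by (auto simp: atLeastLessThanSuc_atLeastAtMost intro!: divide_right_mono)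
  next
    fix y assume y: "\<And>x. x \<in> (\<lambda>m. real (card (A \<inter> {m..m + n})) / real n) ` {1..} \<Longrightarrow> x \<le> y"
    have "a (Suc n) \<le> y * n"
    proof (rule least)
      fix m :: nat assume "1 \<le> m"
      then have "real (card (A \<inter> {m..m + n})) / real n \<le> y" by (intro y) auto
      then show "real (card (A \<inter> {m..<m + Suc n})) \<le> y * n"
        using that by (simp add: atLeastLessThanSuc_atLeastAtMost pos_divide_le_eq)
    qed
    then show "a (Suc n) / n \<le> y" using that by (simp add: pos_divide_le_eq)
  qed auto
  have "(\<lambda>n. a (Suc n) / Suc n * (1 + 1 / n)) \<longlonglongrightarrow> l * (1 + 0)"
    by (intro tendsto_intros LIMSEQ_Suc[OF lim_a] lim_const_over_n)
  moreover have "\<forall>\<^sub>F n in sequentially. a (Suc n) / Suc n * (1 + 1 / n)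
      = (SUP m\<in>{1::nat..}. real (card (A \<inter> {m..m+n})) / real n)"
    using eventually_ge_at_top[of 1]
  proof eventually_elim
    case (elim n)
    then have "1 + 1 / real n = real (Suc n) / n" by (simp add: field_simps)
    then show ?case using elim by (subst density_eq) (simp_all del: of_nat_Suc)
  qed
  ultimately have "(\<lambda>n. SUP m\<in>{1::nat..}. real (card (A \<inter> {m..m+n})) / real n) \<longlonglongrightarrow> l"
    by (auto intro: Lim_transform_eventually)
  then have "banach_density A = l"
    unfolding banach_density_def by (rule limI)
  then have "\<beta> * Suc n < a (Suc n)" for n
    using assms lower[of "Suc n"]
    by (metis le_add1 less_le_trans of_nat_0_less_iff plus_1_eq_Suc pos_less_divide_eq zero_less_Suc)
  then have "\<exists>m\<in>{1..}. \<beta> * Suc n < card (A \<inter> {m..<m + Suc n})" for n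
    unfolding a_def by (subst (asm) less_cSUP_iff[OF _ bdd]) auto
  then have "\<exists>m. \<beta> * Suc n \<le> card (A \<inter> {m..<m + Suc n})" for n
    by (meson less_imp_le)
  then show thesis using that by metis
qed

section \<open>Translates of dense sets\<close>

text \<open>Moving back by \<open>c\<close> keeps every point from \<open>u + c\<close> on inside
  the interval, so only the first \<open>c\<close> positions can be lost.\<close>

lemma card_translate_Int_interval:
  fixes A :: "nat set"
  shows "card (A \<inter> {u..<v}) \<le> card ({x. x + c \<in> A} \<inter> {u..<v}) + c"
proof -
  have "A \<inter> {u..<v} \<subseteq> (\<lambda>x. x + c) ` ({x. x + c \<in> A} \<inter> {u..<v}) \<union> {u..<u + c}"
  proof
    fix y assume y: "y \<in> A \<inter> {u..<v}"
    show "y \<in> (\<lambda>x. x + c) ` ({x. x + c \<in> A} \<inter> {u..<v}) \<union> {u..<u + c}"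
    proof (cases "y < u + c")
      case False
      with y show ?thesis by (intro UnI1 image_eqI[of _ _ "y - c"]) auto
    qed (use y in auto)
  qed
  then have "card (A \<inter> {u..<v}) \<le> card ((\<lambda>x. x + c) ` ({x. x + c \<in> A} \<inter> {u..<v}) \<union> {u..<u + c})"
    by (intro card_mono) auto
  also have "\<dots> \<le> card ((\<lambda>x. x + c) ` ({x. x + c \<in> A} \<inter> {u..<v})) + c"
    using card_Un_le[of _ "{u..<u + c}"] by simp
  also have "\<dots> \<le> card ({x. x + c \<in> A} \<inter> {u..<v}) + c"
    by (simp add: card_image_le)
  finally show ?thesis .
qed

text \<open>Double counting of pairs \<open>x\<close> in \<open>{p..<q}\<close>, \<open>c\<close> in
  \<open>{u..<v}\<close> with \<open>x + c \<in> A\<close>. Each \<open>x\<close> contributes at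
  least \<open>\<beta> * (v - u) - q\<close>, as shifting by \<open>x < q\<close> loses at most
  \<open>x\<close> points; a \<open>c\<close> outside the counted set contributes less than
  \<open>\<gamma> * (q - p)\<close>, any other at most \<open>q - p\<close>.\<close>

lemma dense_translates:
  fixes A :: "nat set" and \<beta> \<gamma> :: real
  assumes "\<beta> * (v - u) \<le> card (A \<inter> {u..<v})" "u \<le> v" "p < q" "0 \<le> \<gamma>"
  shows "(\<beta> - \<gamma>) * (v - u) - q
    \<le> card ({c. \<gamma> * (q - p) \<le> card ({x. x + c \<in> A} \<inter> {p..<q})} \<inter> {u..<v})"
proof -
  define N where "N = real (q - p)"
  define V where "V = real (v - u)"
  have "N > 0" using assms by (simp add: N_def)
  define g where "g c = card ({x. x + c \<in> A} \<inter> {p..<q})" for c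
  define E where "E = {c. \<gamma> * N \<le> g c} \<inter> {u..<v}"
  have fE: "finite E" by (auto simp: E_def)
  have g_le: "g c \<le> N" for c
    using card_mono[of "{p..<q}" "{x. x + c \<in> A} \<inter> {p..<q}"] by (simp add: g_def N_def)
  have "N * (\<beta> * V - q) = (\<Sum>x\<in>{p..<q}. \<beta> * V - q)"
    by (simp add: N_def)
  also have "\<dots> \<le> (\<Sum>x\<in>{p..<q}. real (card ({c. c + x \<in> A} \<inter> {u..<v})))"
  proof (rule sum_mono)
    fix x assume "x \<in> {p..<q}"
    with assms(1) card_translate_Int_interval[of A u v x]
    show "\<beta> * V - q \<le> card ({c. c + x \<in> A} \<inter> {u..<v})"
      unfolding V_def using assms(2) by (simp add: of_nat_diff)
  qed
  also have "\<dots> = (\<Sum>c\<in>{u..<v}. real (g c))"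
  proof -
    have "(\<Sum>c\<in>{u..<v}. card {x\<in>{p..<q}. x + c \<in> A}) = (\<Sum>x\<in>{p..<q}. card {c\<in>{u..<v}. x + c \<in> A})"
      by (rule sum_multicount_gen) auto
    then have "(\<Sum>c\<in>{u..<v}. g c) = (\<Sum>x\<in>{p..<q}. card ({c. c + x \<in> A} \<inter> {u..<v}))"
      by (simp add: g_def Int_def conj_commute add.commute)
    then show ?thesis by (metis of_nat_sum)
  qed
  also have "\<dots> \<le> (\<Sum>c\<in>{u..<v}. \<gamma> * N + (if c \<in> E then N else 0))"
  proof (rule sum_mono)
    fix c assume "c \<in> {u..<v}"
    then show "g c \<le> \<gamma> * N + (if c \<in> E then N else 0)"
      using g_le[of c] assms(4) \<open>N > 0\<close> by (auto simp: E_def intro: add_increasing)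
  qed
  also have "\<dots> = \<gamma> * N * V + N * card E"
  proof -
    have "{u..<v} \<inter> {c. c \<in> E} = E" by (auto simp: E_def)
    then show ?thesis by (simp add: sum.distrib sum.If_cases V_def)
  qed
  finally have "N * ((\<beta> - \<gamma>) * V - q) \<le> N * card E" by (simp add: algebra_simps)
  then show ?thesis
    using \<open>N > 0\<close> assms(2,3) by (simp add: E_def g_def N_def V_def)
qed

section \<open>Building sumsets from translates\<close>

text \<open>Fix \<open>l \<in> B\<close> and rewrite \<open>b + c\<close> as
  \<open>(b - l) + (l + c)\<close>: the shifted \<open>C\<close> consists of sums with
  \<open>l\<close>, so it lies in \<open>A\<close>. Discarding the finitely many
  \<open>b \<le> l\<close> keeps the shifted \<open>B\<close> positive.\<close>

lemma sumset_translate: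
  fixes A :: "nat set"
  assumes "A \<subseteq> {1..}" "infinite B" "infinite C" "\<And>b c. b \<in> B \<Longrightarrow> c \<in> C \<Longrightarrow> b + c \<in> A"
  shows "\<exists>B C. B \<subseteq> {1..} \<and> C \<subseteq> {1..} \<and> infinite B \<and> infinite C \<and> C \<subseteq> A
           \<and> {b + c | b c. b \<in> B \<and> c \<in> C} \<subseteq> A"
proof -
  obtain l where l: "l \<in> B" using assms(2) by (metis ex_in_conv finite.emptyI)
  define B' where "B' = {x. 1 \<le> x \<and> x + l \<in> B}"
  define C' where "C' = (\<lambda>c. l + c) ` C"
  have "B \<subseteq> {..l} \<union> (\<lambda>x. x + l) ` B'"
  proof
    fix b assume "b \<in> B"
    then show "b \<in> {..l} \<union> (\<lambda>x. x + l) ` B'"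
      by (cases "b \<le> l") (auto simp: B'_def intro!: image_eqI[of _ _ "b - l"])
  qed
  then have "infinite B'"
    using assms(2) by (meson finite_Un finite_atMost finite_imageI finite_subset)
  moreover have "infinite C'"
    using assms(3) by (simp add: C'_def finite_image_iff inj_on_def)
  moreover have "C' \<subseteq> A" using l assms(4) by (auto simp: C'_def)
  moreover have "b + c \<in> A" if bc: "b \<in> B'" "c \<in> C'" for b c
  proof -
    obtain c' where "c' \<in> C" "c = l + c'" using bc by (auto simp: C'_def)
    with bc assms(4)[of "b + l" c'] show ?thesis by (simp add: B'_def add.assoc)
  qed
  moreover have "B' \<subseteq> {1..}" by (auto simp: B'_def)
  ultimately show ?thesis
    using assms(1) by (intro exI[of _ B'] exI[of _ C']) blast
qed

lemma infinite_range_ge: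
  fixes f :: "nat \<Rightarrow> nat"
  assumes "\<And>n. n \<le> f n"
  shows "infinite (range f)"
  unfolding infinite_nat_iff_unbounded_le using assms by blast

text \<open>The infinite intersections supply \<open>b k\<close> in \<open>L\<close> with
  \<open>b k + c i \<in> A\<close> for \<open>i \<le> k\<close>, and membership in \<open>L\<close>
  gives the same for all large \<open>i\<close>.\<close>

lemma sumset_of_converging_translates:
  fixes A L :: "nat set" and c :: "nat \<Rightarrow> nat"
  assumes c: "\<And>k. k \<le> c k" and conv: "\<And>x. x \<in> L \<Longrightarrow> \<forall>\<^sub>F k in sequentially. x + c k \<in> A"
    and inf: "\<And>k. infinite (\<Inter>i\<le>k. L \<inter> {x. x + c i \<in> A})"
  shows "\<exists>B C. infinite B \<and> infinite C \<and> (\<forall>b\<in>B. \<forall>c\<in>C. b + c \<in> A)"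
proof -
  have "\<exists>b. k \<le> b \<and> b \<in> (\<Inter>i\<le>k. L \<inter> {x. x + c i \<in> A})" for k
    using inf[of k] unfolding infinite_nat_iff_unbounded_le by blast
  then obtain b where b: "\<And>k. k \<le> b k" "\<And>k. b k \<in> (\<Inter>i\<le>k. L \<inter> {x. x + c i \<in> A})"
    by metis
  have early: "b k + c i \<in> A" if "i \<le> k" for i k using b(2)[of k] that by auto
  have "b k \<in> L" for k using b(2)[of k] by auto
  then have "\<exists>K. \<forall>k\<ge>K. b j + c k \<in> A" for j
    using conv unfolding eventually_sequentially by blast
  then obtain K where late: "\<And>j k. K j \<le> k \<Longrightarrow> b j + c k \<in> A" by metis
  text \<open>b j + c i lies in A both for i at most j and for i large in terms of j, so it suffices
    to thin out both sequences along a rapidly growing common subsequence.\<close>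
  define h where "h = rec_nat 0 (\<lambda>_ m. max (Suc m) (K m))"
  have h: "h (Suc n) = max (Suc (h n)) (K (h n))" for n by (simp add: h_def)
  then have mono: "strict_mono h" by (simp add: strict_mono_Suc_iff less_max_iff_disj)
  have "b (h m) + c (h n) \<in> A" for m n
  proof (cases "n \<le> m")
    case True
    then show ?thesis using early mono by (simp add: strict_mono_less_eq)
  next
    case False
    then have "h (Suc m) \<le> h n" using mono by (simp add: strict_mono_less_eq)
    then show ?thesis using late h[of m] by simp
  qed
  moreover have "infinite (range (b \<circ> h))" "infinite (range (c \<circ> h))"
    using b(1) c seq_suble[OF mono] by (auto intro!: infinite_range_ge intro: order_trans)
  ultimately show ?thesis
    by (intro exI[of _ "range (b \<circ> h)"] exI[of _ "range (c \<circ> h)"]) auto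
qed

section \<open>The limit of dense translates and its overlap with them\<close>

theorem theorem1p2:
  fixes A :: "nat set"
  assumes "A \<subseteq> {1..}"
    and "banach_density A > 1/2"
  shows "\<exists>B C. B \<subseteq> {1..} \<and> C \<subseteq> {1..} \<and> infinite B \<and> infinite C \<and> C \<subseteq> A
           \<and> {b + c | b c. b \<in> B \<and> c \<in> C} \<subseteq> A"
proof -
  \<comment> \<open>The gap \<open>\<beta> - \<gamma>\<close> drives the first use of
    intersectivity, and \<open>\<beta> + \<gamma> > 1\<close> the second.\<close>
  obtain \<beta> where \<beta>: "1 / 2 < \<beta>" "\<beta> < banach_density A"
    using assms(2) dense by blast
  obtain \<gamma> where \<gamma>: "1 / 2 < \<gamma>" "\<gamma> < \<beta>"
    using \<beta>(1) dense by blast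
  obtain u where u: "\<And>n. \<beta> * Suc n \<le> card (A \<inter> {u n..<u n + Suc n})"
    using banach_density_intervals[OF \<beta>(2)] by blast
  define I where "I n = {u n..<u n + Suc n}" for n
  have fin_I: "finite (I n)" and card_I: "card (I n) = Suc n" for n by (simp_all add: I_def)
  have eventually_large: "\<forall>\<^sub>F n in sequentially. K \<le> \<epsilon> * Suc n" if "\<epsilon> > 0" for \<epsilon> K :: real
    using that by real_asymp
  \<comment> \<open>The shifts themselves become points: \<open>E n\<close> collects those that are
    good on \<open>I n\<close>, and its density is measured along the intervals
    \<open>I m\<close>.\<close>
  define E where "E n = {c. \<gamma> * Suc n \<le> card ({x. x + c \<in> A} \<inter> I n)}" for n
  have E_dense: "\<forall>\<^sub>F m in sequentially. (\<beta> - \<gamma>) / 2 * card (I m) \<le> card (E n \<inter> I m)" for n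
  proof -
    \<comment> \<open>The error term from \<open>dense_translates\<close> does not depend on
      \<open>m\<close>, so half of the gap absorbs it.\<close>
    have "\<forall>\<^sub>F m in sequentially. u n + Suc n \<le> (\<beta> - \<gamma>) / 2 * Suc m"
      using \<gamma>(2) by (intro eventually_large) simp
    then show ?thesis
    proof eventually_elim
      case (elim m)
      then show ?case
        using dense_translates[of \<beta> "u m + Suc m" "u m" A "u n" "u n + Suc n" \<gamma>] u[of m] \<gamma>(1)
        by (simp add: E_def I_def algebra_simps add_divide_distrib diff_divide_distrib)
    qed
  qed
  have card_lim: "filterlim (\<lambda>m. card (I m)) at_top sequentially"
    unfolding card_I by (rule filterlim_Suc)
  have "0 < (\<beta> - \<gamma>) / 2" using \<gamma>(2) by simp
  from bergelson_intersectivity[where E = E, OF fin_I card_lim this E_dense]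
  obtain s :: "nat \<Rightarrow> nat" where s: "strict_mono s" "\<And>k. infinite (\<Inter>i\<le>k. E (s i))"
    by blast
  have "\<exists>c. k \<le> c \<and> c \<in> (\<Inter>i\<le>k. E (s i))" for k
    using s(2)[of k] unfolding infinite_nat_iff_unbounded_le by blast
  then obtain c0 where c0: "\<And>k. k \<le> c0 k" "\<And>k. c0 k \<in> (\<Inter>i\<le>k. E (s i))"
    by metis
  \<comment> \<open>Compactness of 0-1 sequences: along a diagonal subsequence, membership of each
    \<open>x\<close> in the translates stabilises.\<close>
  obtain r where r: "strict_mono r"
    "\<And>x. \<exists>l. (\<lambda>k. indicator A (x + c0 (r k)) :: real) \<longlonglongrightarrow> l"
    using function_convergent_subsequence[of "UNIV :: nat set" "\<lambda>k x. indicator A (x + c0 k) :: real" 1]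
    by (auto simp: indicator_def)
  define c where "c = c0 \<circ> r"
  have c_ge: "k \<le> c k" for k
    using c0(1)[of "r k"] seq_suble[OF r(1), of k] by (simp add: c_def)
  have c_E: "c k \<in> E (s i)" if "i \<le> k" for i k
    using c0(2)[of "r k"] seq_suble[OF r(1), of k] that by (auto simp: c_def)
  \<comment> \<open>Only eventual membership is asked for here; convergence of the indicators
    ensures that nonmembers are eventually absent, so \<open>L\<close> is the pointwise
    limit.\<close>
  define L where "L = {x. \<forall>\<^sub>F k in sequentially. x + c k \<in> A}"
  have L: "\<forall>\<^sub>F k in sequentially. x + c k \<in> A \<longleftrightarrow> x \<in> L" for x
  proof -
    obtain l where l: "(\<lambda>k. indicator A (x + c k) :: real) \<longlonglongrightarrow> l"
      using r(2) by (auto simp: c_def)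
    show ?thesis
    proof (cases "0 < l")
      case True
      from order_tendstoD(1)[OF l this] have ev: "\<forall>\<^sub>F k in sequentially. x + c k \<in> A"
        by eventually_elim (auto simp: indicator_def split: if_splits)
      then have "x \<in> L" by (simp add: L_def)
      with ev show ?thesis by simp
    next
      case False
      then have "l < 1" by simp
      from order_tendstoD(2)[OF l this] have ev: "\<forall>\<^sub>F k in sequentially. x + c k \<notin> A"
        by eventually_elim (auto simp: indicator_def split: if_splits)
      have "x \<notin> L"
      proof
        assume "x \<in> L"
        then have "\<forall>\<^sub>F k in sequentially. x + c k \<in> A" by (simp add: L_def)
        with ev have "\<forall>\<^sub>F k in sequentially. False" by eventually_elim simp
        then show False by simp
      qed
      with ev show ?thesis by simp
    qed
  qed
  have L_dense: "\<gamma> * card (I (s i)) \<le> card (L \<inter> I (s i))" for i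
  proof -
    \<comment> \<open>Convergence is uniform on a finite interval, so some translate with
      \<open>k \<ge> i\<close> agrees with \<open>L\<close> there and passes its density on to
      \<open>L\<close>.\<close>
    have "\<forall>\<^sub>F k in sequentially. \<forall>x\<in>I (s i). x + c k \<in> A \<longleftrightarrow> x \<in> L"
      using L fin_I by (intro eventually_ball_finite) auto
    then have "\<forall>\<^sub>F k in sequentially. i \<le> k \<and> (\<forall>x\<in>I (s i). x + c k \<in> A \<longleftrightarrow> x \<in> L)"
      by (intro eventually_conj eventually_ge_at_top)
    then obtain k where k: "i \<le> k" "\<And>x. x \<in> I (s i) \<Longrightarrow> x + c k \<in> A \<longleftrightarrow> x \<in> L"
      using eventually_happens'[OF sequentially_bot] by blast
    then have "{x. x + c k \<in> A} \<inter> I (s i) = L \<inter> I (s i)" by auto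
    with c_E[OF k(1)] show ?thesis by (simp add: E_def card_I)
  qed
  define E' where "E' k = L \<inter> {x. x + c k \<in> A}" for k
  have E'_dense: "\<forall>\<^sub>F m in sequentially. (\<beta> + \<gamma> - 1) / 2 * card (I (s m)) \<le> card (E' k \<inter> I (s m))" for k
  proof -
    \<comment> \<open>Inclusion-exclusion gives density at least
      \<open>\<beta> + \<gamma> - 1\<close> up to the \<open>c k\<close> points lost by shifting;
      halving the bound absorbs this fixed loss.\<close>
    have "\<forall>\<^sub>F n in sequentially. c k \<le> (\<beta> + \<gamma> - 1) / 2 * Suc n"
      using \<beta>(1) \<gamma>(1) by (intro eventually_large) simp
    then have "\<forall>\<^sub>F m in sequentially. c k \<le> (\<beta> + \<gamma> - 1) / 2 * Suc (s m)"
      using filterlim_subseq[OF s(1)] by (rule eventually_compose_filterlim)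
    then show ?thesis
    proof eventually_elim
      case (elim m)
      let ?X = "L \<inter> I (s m)" and ?Y = "{x. x + c k \<in> A} \<inter> I (s m)"
      have "\<beta> * card (I (s m)) - c k \<le> card ?Y"
        using u[of "s m"] card_translate_Int_interval[of A "u (s m)" "u (s m) + Suc (s m)" "c k"]
        by (simp add: I_def)
      moreover have "card ?X + card ?Y = card (?X \<union> ?Y) + card (?X \<inter> ?Y)"
        using fin_I by (intro card_Un_Int) auto
      moreover have "card (?X \<union> ?Y) \<le> card (I (s m))"
        using fin_I by (intro card_mono) auto
      moreover have "?X \<inter> ?Y = E' k \<inter> I (s m)" by (auto simp: E'_def)
      ultimately have "(\<beta> + \<gamma> - 1) * card (I (s m)) - c k \<le> card (E' k \<inter> I (s m))"
        using L_dense[of m] by (simp add: algebra_simps)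
      with elim show ?case by (simp add: card_I field_simps)
    qed
  qed
  have card_lim': "filterlim (\<lambda>m. card (I (s m))) at_top sequentially"
    using filterlim_compose[OF card_lim filterlim_subseq[OF s(1)]] .
  have "0 < (\<beta> + \<gamma> - 1) / 2" using \<beta>(1) \<gamma>(1) by simp
  from bergelson_intersectivity[where E = E', OF fin_I card_lim' this E'_dense]
  obtain t :: "nat \<Rightarrow> nat" where t: "strict_mono t" "\<And>k. infinite (\<Inter>i\<le>k. E' (t i))"
    by blast
  have "k \<le> c (t k)" for k
    using c_ge seq_suble[OF t(1)] order_trans by blast
  moreover have "\<forall>\<^sub>F k in sequentially. x + c (t k) \<in> A" if "x \<in> L" for x
    using that filterlim_subseq[OF t(1)] unfolding L_def mem_Collect_eq
    by (rule eventually_compose_filterlim)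
  ultimately obtain B C where "infinite B" "infinite C" "\<And>b c. b \<in> B \<Longrightarrow> c \<in> C \<Longrightarrow> b + c \<in> A"
    using sumset_of_converging_translates[of "\<lambda>k. c (t k)" L A, OF _ _ t(2)[unfolded E'_def]]
    by meson
  then show ?thesis by (rule sumset_translate[OF assms(1)])
qed

end
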